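(* Let $P_0$ and $R_0$ be non-isomorphic posets, each of size $m$, let $i\ge 1$, and let $P_iR_i$ be as defined below. Then no witness of $D_{i+m+1}(P_iR_i)$ has size less than $|P_iR_i|=2m+2i$.
   Context: For $i\ge0$, $P_i$ (resp. $R_i$) is the poset obtained by placing $P_0$ (resp. $R_0$) above a chain of $i$ elements (every element of $P_0$ above every chain element), and $P_iR_i$ is the disjoint union of $P_i$ and $R_i$. A downset is a downward-closed subset; $D_n(Q)$ is the set of downsets of $Q$ of size $n$ up to isomorphism. A poset $Q$ is a witness of a set $\Gamma_n$ of unlabelled posets of size $n$ if $D_n(Q)=\Gamma_n$. *)

theory Defs
  imports Main
begin

definition fin_poset :: "'a set \<Rightarrow> 'a rel \<Rightarrow> bool" where
  "fin_poset A r \<longleftrightarrow> finite A \<and> r \<subseteq> A \<times> A \<and> (\<forall>x\<in>A. (x, x) \<in> r)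
     \<and> antisym r \<and> trans r"

definition poset_iso :: "'a set \<Rightarrow> 'a rel \<Rightarrow> 'b set \<Rightarrow> 'b rel \<Rightarrow> bool" where
  "poset_iso A r B s \<longleftrightarrow> (\<exists>f. bij_betw f A B \<and>
     (\<forall>x\<in>A. \<forall>y\<in>A. (x, y) \<in> r \<longleftrightarrow> (f x, f y) \<in> s))"

definition is_downset :: "'a set \<Rightarrow> 'a rel \<Rightarrow> 'a set \<Rightarrow> bool" where
  "is_downset A r D \<longleftrightarrow> D \<subseteq> A \<and> (\<forall>x\<in>D. \<forall>y\<in>A. (y, x) \<in> r \<longrightarrow> y \<in> D)"

definition restr :: "'a rel \<Rightarrow> 'a set \<Rightarrow> 'a rel" where
  "restr r D = r \<inter> (D \<times> D)"

text \<open>(C,t) is (up to isomorphism) a member of D_n(A,r).\<close>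
definition in_Dn :: "nat \<Rightarrow> 'a set \<Rightarrow> 'a rel \<Rightarrow> 'b set \<Rightarrow> 'b rel \<Rightarrow> bool" where
  "in_Dn n A r C t \<longleftrightarrow> (\<exists>D. is_downset A r D \<and> card D = n \<and> poset_iso D (restr r D) C t)"

text \<open>D_n(A,r) = D_n(B,s) as sets of isomorphism classes.\<close>
definition same_Dn :: "nat \<Rightarrow> 'a set \<Rightarrow> 'a rel \<Rightarrow> 'b set \<Rightarrow> 'b rel \<Rightarrow> bool" where
  "same_Dn n A r B s \<longleftrightarrow>
     (\<forall>D. is_downset A r D \<and> card D = n \<longrightarrow> in_Dn n B s D (restr r D)) \<and>
     (\<forall>E. is_downset B s E \<and> card E = n \<longrightarrow> in_Dn n A r E (restr s E))"

definition is_witness :: "'b set \<Rightarrow> 'b rel \<Rightarrow> nat \<Rightarrow> 'a set \<Rightarrow> 'a rel \<Rightarrow> bool" where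
  "is_witness Q q n A r \<longleftrightarrow> fin_poset Q q \<and> same_Dn n Q q A r"

text \<open>P_i: the poset (A,r) placed above a chain 0 < 1 < ... < i-1.
  Elements of P_0 are tagged Inl, chain elements Inr.\<close>
definition stack_carrier :: "nat \<Rightarrow> 'a set \<Rightarrow> ('a + nat) set" where
  "stack_carrier i A = Inl ` A \<union> Inr ` {0..<i}"

definition stack_rel :: "nat \<Rightarrow> 'a set \<Rightarrow> 'a rel \<Rightarrow> ('a + nat) rel" where
  "stack_rel i A r =
     {(Inl x, Inl y) | x y. (x, y) \<in> r} \<union>
     {(Inr j, Inr k) | j k. j \<le> k \<and> k < i} \<union>
     {(Inr j, Inl x) | j x. j < i \<and> x \<in> A}"

definition dunion_carrier :: "'a set \<Rightarrow> 'b set \<Rightarrow> ('a + 'b) set" where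
  "dunion_carrier A B = Inl ` A \<union> Inr ` B"

definition dunion_rel :: "'a rel \<Rightarrow> 'b rel \<Rightarrow> ('a + 'b) rel" where
  "dunion_rel r s = {(Inl x, Inl y) | x y. (x, y) \<in> r} \<union> {(Inr x, Inr y) | x y. (x, y) \<in> s}"

end

theory Submission
  imports Defs
begin

(* Let n = i + m + 1. The downsets of size n of P_iR_i are P_i and R_i, each enlarged by the
   bottom of the other component; P_i and R_i themselves are downsets of these. Hence a
   witness Q contains downsets X and Y isomorphic to P_i and R_i, both with a least element.
   No downset of size n of P_iR_i has a least element, since it meets both components, so
   neither does one of Q. If X and Y met but differed, X together with a minimal element of
   Y - X would be such a downset with a least element; if X = Y, then P_i and R_i would be
   isomorphic, and so would P_0 and R_0, as an isomorphism must match the elements having more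
   than i elements below them. So X and Y are disjoint and |Q| >= 2(m + i). *)

definition has_least :: "'a set \<Rightarrow> 'a rel \<Rightarrow> bool" where
  "has_least A r \<longleftrightarrow> (\<exists>z\<in>A. \<forall>v\<in>A. (z, v) \<in> r)"

definition below :: "'a set \<Rightarrow> 'a rel \<Rightarrow> 'a \<Rightarrow> 'a set" where
  "below A r v = {u \<in> A. (u, v) \<in> r}"

subsection \<open>Isomorphisms\<close>

lemma poset_iso_sym:
  assumes "poset_iso A r B s" shows "poset_iso B s A r"
proof -
  from assms obtain f where f: "bij_betw f A B"
    and h: "\<forall>x\<in>A. \<forall>y\<in>A. (x, y) \<in> r \<longleftrightarrow> (f x, f y) \<in> s"
    unfolding poset_iso_def by blast
  let ?g = "inv_into A f"
  have g: "bij_betw ?g B A" using f by (rule bij_betw_inv_into)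
  have "(x, y) \<in> s \<longleftrightarrow> (?g x, ?g y) \<in> r" if "x \<in> B" "y \<in> B" for x y
  proof -
    have "?g x \<in> A" "?g y \<in> A" using that g bij_betw_apply by metis+
    moreover have "f (?g x) = x" "f (?g y) = y"
      using that f by (simp_all add: bij_betw_inv_into_right)
    ultimately show ?thesis using h by metis
  qed
  then show ?thesis using g unfolding poset_iso_def by blast
qed

lemma poset_iso_trans:
  assumes "poset_iso A r B s" "poset_iso B s C t" shows "poset_iso A r C t"
proof -
  from assms(1) obtain f where f: "bij_betw f A B"
    and hf: "\<forall>x\<in>A. \<forall>y\<in>A. (x, y) \<in> r \<longleftrightarrow> (f x, f y) \<in> s"
    unfolding poset_iso_def by blast
  from assms(2) obtain g where g: "bij_betw g B C"
    and hg: "\<forall>x\<in>B. \<forall>y\<in>B. (x, y) \<in> s \<longleftrightarrow> (g x, g y) \<in> t"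
    unfolding poset_iso_def by blast
  have "bij_betw (g \<circ> f) A C" using f g by (rule bij_betw_trans)
  moreover have "(x, y) \<in> r \<longleftrightarrow> ((g \<circ> f) x, (g \<circ> f) y) \<in> t" if "x \<in> A" "y \<in> A" for x y
    using that hf hg bij_betw_apply[OF f] by simp
  ultimately show ?thesis unfolding poset_iso_def by blast
qed

lemma poset_iso_card: "poset_iso A r B s \<Longrightarrow> card A = card B"
  unfolding poset_iso_def by (blast intro: bij_betw_same_card)

lemma poset_iso_onto_image:
  assumes f: "bij_betw f A B" and h: "\<forall>x\<in>A. \<forall>y\<in>A. (x, y) \<in> r \<longleftrightarrow> (f x, f y) \<in> s"
    and "U \<subseteq> A"
  shows "poset_iso U (restr r U) (f ` U) (restr s (f ` U))"
  unfolding poset_iso_def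
proof (intro exI conjI)
  show "bij_betw f U (f ` U)"
    using inj_on_subset[OF bij_betw_imp_inj_on[OF f] \<open>U \<subseteq> A\<close>] by (simp add: bij_betw_def)
  show "\<forall>x\<in>U. \<forall>y\<in>U. (x, y) \<in> restr r U \<longleftrightarrow> (f x, f y) \<in> restr s (f ` U)"
    using h \<open>U \<subseteq> A\<close> by (auto simp: restr_def)
qed

lemma card_below_iso:
  assumes f: "bij_betw f A B" and h: "\<forall>x\<in>A. \<forall>y\<in>A. (x, y) \<in> r \<longleftrightarrow> (f x, f y) \<in> s"
    and v: "v \<in> A"
  shows "card (below A r v) = card (below B s (f v))"
proof -
  have "f ` below A r v = below B s (f v)"
  proof
    show "f ` below A r v \<subseteq> below B s (f v)"
      using h v bij_betw_apply[OF f] by (auto simp: below_def)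
    show "below B s (f v) \<subseteq> f ` below A r v"
    proof
      fix w assume w: "w \<in> below B s (f v)"
      then obtain u where "u \<in> A" "w = f u"
        using bij_betw_imp_surj_on[OF f] by (auto simp: below_def)
      then show "w \<in> f ` below A r v" using h v w by (auto simp: below_def)
    qed
  qed
  moreover have "inj_on f (below A r v)"
    using inj_on_subset[OF bij_betw_imp_inj_on[OF f]] by (auto simp: below_def)
  ultimately show ?thesis by (metis card_image)
qed

subsection \<open>Downsets and least elements\<close>

lemma has_least_restr: "has_least A (restr r A) \<longleftrightarrow> has_least A r"
  by (auto simp: has_least_def restr_def)

lemma has_least_iso:
  assumes "poset_iso A r B s" "has_least A r" shows "has_least B s"
proof -
  from assms(1) obtain f where f: "bij_betw f A B"
    and h: "\<forall>x\<in>A. \<forall>y\<in>A. (x, y) \<in> r \<longleftrightarrow> (f x, f y) \<in> s"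
    unfolding poset_iso_def by blast
  from assms(2) obtain z where z: "z \<in> A" "\<forall>v\<in>A. (z, v) \<in> r"
    unfolding has_least_def by blast
  have "\<forall>w\<in>B. (f z, w) \<in> s"
    using bij_betw_imp_surj_on[OF f] h z by auto
  then show ?thesis using bij_betw_apply[OF f z(1)] unfolding has_least_def by blast
qed

lemma finite_downset: "fin_poset Q q \<Longrightarrow> is_downset Q q X \<Longrightarrow> finite X"
  unfolding fin_poset_def is_downset_def using finite_subset by blast

lemma is_downset_Un:
  "is_downset A r U \<Longrightarrow> is_downset A r V \<Longrightarrow> is_downset A r (U \<union> V)"
  by (auto simp: is_downset_def)

lemma is_downset_restr:
  "is_downset T t U \<Longrightarrow> U \<subseteq> D \<Longrightarrow> D \<subseteq> T \<Longrightarrow> is_downset D (restr t D) U"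
  by (auto simp: is_downset_def restr_def)

lemma is_downset_trans:
  "is_downset Q q D \<Longrightarrow> is_downset D (restr q D) X \<Longrightarrow> is_downset Q q X"
  by (simp add: is_downset_def restr_def) blast

lemma poset_iso_downset_image:
  assumes "poset_iso A r B s" "is_downset A r U"
  shows "\<exists>V. is_downset B s V \<and> poset_iso U (restr r U) V (restr s V)"
proof -
  from assms(1) obtain f where f: "bij_betw f A B"
    and h: "\<forall>x\<in>A. \<forall>y\<in>A. (x, y) \<in> r \<longleftrightarrow> (f x, f y) \<in> s"
    unfolding poset_iso_def by blast
  have UA: "U \<subseteq> A" using assms(2) by (simp add: is_downset_def)
  have "is_downset B s (f ` U)"
    unfolding is_downset_def
  proof (intro conjI ballI impI)
    show "f ` U \<subseteq> B" using UA bij_betw_apply[OF f] by blast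
    fix x w assume x: "x \<in> f ` U" and w: "w \<in> B" and wx: "(w, x) \<in> s"
    obtain u where u: "u \<in> U" "x = f u" using x by blast
    obtain v where v: "v \<in> A" "w = f v" using w bij_betw_imp_surj_on[OF f] by blast
    have "(v, u) \<in> r" using h u v wx UA by blast
    then show "w \<in> f ` U" using assms(2) u v unfolding is_downset_def by blast
  qed
  then show ?thesis using poset_iso_onto_image[OF f h UA] by blast
qed

lemma same_Dn_sub_downset:
  assumes "same_Dn n Q q T t" "is_downset T t D" "card D = n"
    and "is_downset T t U" "U \<subseteq> D"
  shows "\<exists>X. is_downset Q q X \<and> poset_iso U (restr t U) X (restr q X)"
proof -
  have "in_Dn n Q q D (restr t D)" using assms(1-3) unfolding same_Dn_def by blast
  then obtain A where A: "is_downset Q q A" and iso: "poset_iso A (restr q A) D (restr t D)"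
    unfolding in_Dn_def by blast
  have "is_downset D (restr t D) U"
    using assms(2,4,5) by (intro is_downset_restr) (auto simp: is_downset_def)
  then obtain X where X: "is_downset A (restr q A) X"
    and isoX: "poset_iso U (restr (restr t D) U) X (restr (restr q A) X)"
    using poset_iso_downset_image[OF poset_iso_sym[OF iso]] by blast
  have "restr (restr t D) U = restr t U" "restr (restr q A) X = restr q X"
    using assms(5) X by (auto simp: is_downset_def restr_def)
  then show ?thesis using is_downset_trans[OF A X] isoX by auto
qed

lemma same_Dn_has_least:
  assumes "same_Dn n Q q T t" "is_downset Q q D" "card D = n" "has_least D q"
  shows "\<exists>D'. is_downset T t D' \<and> card D' = n \<and> has_least D' t"
proof -
  have "in_Dn n T t D (restr q D)" using assms(1-3) unfolding same_Dn_def by blast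
  then obtain D' where "is_downset T t D'" "card D' = n"
    and iso: "poset_iso D' (restr t D') D (restr q D)"
    unfolding in_Dn_def by blast
  moreover have "has_least D' t"
    using has_least_iso[OF poset_iso_sym[OF iso]] assms(4) by (simp add: has_least_restr)
  ultimately show ?thesis by blast
qed

lemma finite_poset_has_minimal:
  assumes "fin_poset Q q" "S \<subseteq> Q" "S \<noteq> {}"
  obtains y where "y \<in> S" "\<forall>u\<in>S. (u, y) \<in> q \<longrightarrow> u = y"
proof -
  have "q \<subseteq> Q \<times> Q" "finite Q" "antisym q" "trans q"
    using assms(1) by (auto simp: fin_poset_def)
  have "finite (q - Id)"
    using \<open>q \<subseteq> Q \<times> Q\<close> \<open>finite Q\<close> by (meson Diff_subset finite_SigmaI finite_subset)
  moreover have "trans (q - Id)"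
    using \<open>antisym q\<close> \<open>trans q\<close> unfolding trans_def antisym_def by blast
  then have "acyclic (q - Id)" by (simp add: acyclic_def)
  ultimately have "wf (q - Id)" by (rule finite_acyclic_wf)
  then obtain y where "y \<in> S" "\<And>u. (u, y) \<in> q - Id \<Longrightarrow> u \<notin> S"
    using wfE_min' assms(3) by blast
  then show thesis using that by blast
qed

lemma downsets_with_least_disjoint_or_eq:
  assumes Q: "fin_poset Q q"
    and X: "is_downset Q q X" "has_least X q" and Y: "is_downset Q q Y" "has_least Y q"
    and card_eq: "card X = card Y"
    and no_least: "\<And>D. is_downset Q q D \<Longrightarrow> card D = Suc (card X) \<Longrightarrow> \<not> has_least D q"
  shows "X \<inter> Y = {} \<or> X = Y"
proof (rule ccontr)
  assume "\<not> ?thesis"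
  then obtain w where w: "w \<in> X" "w \<in> Y" and "X \<noteq> Y" by blast
  obtain z where z: "z \<in> X" "\<forall>v\<in>X. (z, v) \<in> q" using X(2) unfolding has_least_def by blast
  obtain z' where z': "z' \<in> Y" "\<forall>v\<in>Y. (z', v) \<in> q" using Y(2) unfolding has_least_def by blast
  have "(z', w) \<in> q" "z' \<in> Q" using z' w Y(1) unfolding is_downset_def by auto
  then have "z' \<in> X" using X(1) w(1) unfolding is_downset_def by blast
  have fin: "finite X" using Q X(1) by (rule finite_downset)
  have "Y - X \<noteq> {}" using card_subset_eq[OF fin _ card_eq[symmetric]] \<open>X \<noteq> Y\<close> by blast
  moreover have "Y - X \<subseteq> Q" using Y(1) unfolding is_downset_def by blast
  ultimately obtain y where y: "y \<in> Y" "y \<notin> X" and y_min: "\<forall>u\<in>Y - X. (u, y) \<in> q \<longrightarrow> u = y"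
    using finite_poset_has_minimal[OF Q] by (metis DiffD1 DiffD2)
  have "is_downset Q q (insert y X)"
    unfolding is_downset_def
  proof (intro conjI ballI impI)
    show "insert y X \<subseteq> Q" using X(1) Y(1) y unfolding is_downset_def by blast
    fix x v assume x: "x \<in> insert y X" and "v \<in> Q" "(v, x) \<in> q"
    then consider "x = y" | "x \<in> X" by blast
    then show "v \<in> insert y X"
    proof cases
      case 1
      then have "v \<in> Y" using Y(1) y \<open>v \<in> Q\<close> \<open>(v, x) \<in> q\<close> unfolding is_downset_def by blast
      then show ?thesis using y_min 1 \<open>(v, x) \<in> q\<close> by blast
    next
      case 2
      then show ?thesis using X(1) \<open>v \<in> Q\<close> \<open>(v, x) \<in> q\<close> unfolding is_downset_def by blast
    qed
  qed
  moreover have "card (insert y X) = Suc (card X)" using fin y by simp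
  moreover have "has_least (insert y X) q"
  proof -
    have "(z, z') \<in> q" "(z', y) \<in> q" using z \<open>z' \<in> X\<close> z' y by blast+
    then have "(z, y) \<in> q" using Q unfolding fin_poset_def by (meson transE)
    then show ?thesis using z unfolding has_least_def by blast
  qed
  ultimately show False using no_least by blast
qed

subsection \<open>Disjoint unions\<close>

lemma is_downset_dunion_Inl:
  "is_downset A r U \<Longrightarrow> is_downset (dunion_carrier A B) (dunion_rel r s) (Inl ` U)"
  by (auto simp: is_downset_def dunion_carrier_def dunion_rel_def)

lemma is_downset_dunion_Inr:
  "is_downset B s U \<Longrightarrow> is_downset (dunion_carrier A B) (dunion_rel r s) (Inr ` U)"
  by (auto simp: is_downset_def dunion_carrier_def dunion_rel_def)

lemma poset_iso_dunion_Inl: "poset_iso A r (Inl ` A) (restr (dunion_rel r s) (Inl ` A))"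
  unfolding poset_iso_def
  by (rule exI[of _ Inl]) (auto simp: bij_betw_def inj_on_def restr_def dunion_rel_def)

lemma poset_iso_dunion_Inr: "poset_iso B s (Inr ` B) (restr (dunion_rel r s) (Inr ` B))"
  unfolding poset_iso_def
  by (rule exI[of _ Inr]) (auto simp: bij_betw_def inj_on_def restr_def dunion_rel_def)

lemma dunion_not_has_least:
  assumes "finite A" "finite B" "D \<subseteq> dunion_carrier A B"
    and "card A < card D" "card B < card D"
  shows "\<not> has_least D (dunion_rel r s)"
proof
  assume "has_least D (dunion_rel r s)"
  then obtain z where z: "z \<in> D" "\<forall>v\<in>D. (z, v) \<in> dunion_rel r s"
    unfolding has_least_def by blast
  have "D \<subseteq> Inl ` A \<or> D \<subseteq> Inr ` B"
  proof (cases z)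
    case (Inl a)
    then have "D \<subseteq> Inl ` A" using assms(3) z(2) by (auto simp: dunion_carrier_def dunion_rel_def)
    then show ?thesis ..
  next
    case (Inr b)
    then have "D \<subseteq> Inr ` B" using assms(3) z(2) by (auto simp: dunion_carrier_def dunion_rel_def)
    then show ?thesis ..
  qed
  then show False
  proof
    assume "D \<subseteq> Inl ` A"
    then have "card D \<le> card A" using assms(1) card_mono[of "Inl ` A" D] by (simp add: card_image)
    then show False using assms(4) by simp
  next
    assume "D \<subseteq> Inr ` B"
    then have "card D \<le> card B" using assms(2) card_mono[of "Inr ` B" D] by (simp add: card_image)
    then show False using assms(5) by simp
  qed
qed

lemma witness_downset_not_has_least:
  assumes "is_witness Q q (Suc n) (dunion_carrier A B) (dunion_rel r s)"
    and "finite A" "finite B" "card A \<le> n" "card B \<le> n"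
    and "is_downset Q q D" "card D = Suc n"
  shows "\<not> has_least D q"
proof
  assume "has_least D q"
  then obtain D' where "is_downset (dunion_carrier A B) (dunion_rel r s) D'"
    and "card D' = Suc n" and "has_least D' (dunion_rel r s)"
    using same_Dn_has_least assms(1,6,7) unfolding is_witness_def by blast
  then show False
    using dunion_not_has_least[OF assms(2,3), of D'] assms(4,5) by (simp add: is_downset_def)
qed

lemma witness_has_Inl_component:
  assumes "is_witness Q q (Suc (card A)) (dunion_carrier A B) (dunion_rel r s)"
    and "finite A" "is_downset B s {b}"
  shows "\<exists>X. is_downset Q q X \<and> poset_iso A r X (restr q X)"
proof -
  have component: "is_downset (dunion_carrier A B) (dunion_rel r s) (Inl ` A)"
    by (rule is_downset_dunion_Inl) (simp add: is_downset_def)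
  have "is_downset (dunion_carrier A B) (dunion_rel r s) (Inl ` A \<union> Inr ` {b})"
    using component is_downset_dunion_Inr[OF assms(3)] by (rule is_downset_Un)
  moreover have "card (Inl ` A \<union> Inr ` {b}) = Suc (card A)"
    using assms(2) by (subst card_Un_disjoint) (auto simp: card_image)
  moreover have "same_Dn (Suc (card A)) Q q (dunion_carrier A B) (dunion_rel r s)"
    using assms(1) by (simp add: is_witness_def)
  ultimately obtain X where "is_downset Q q X"
    and "poset_iso (Inl ` A) (restr (dunion_rel r s) (Inl ` A)) X (restr q X)"
    using same_Dn_sub_downset[OF _ _ _ component Un_upper1] by blast
  then show ?thesis using poset_iso_trans[OF poset_iso_dunion_Inl] by blast
qed

lemma witness_has_Inr_component:
  assumes "is_witness Q q (Suc (card B)) (dunion_carrier A B) (dunion_rel r s)"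
    and "finite B" "is_downset A r {a}"
  shows "\<exists>Y. is_downset Q q Y \<and> poset_iso B s Y (restr q Y)"
proof -
  have component: "is_downset (dunion_carrier A B) (dunion_rel r s) (Inr ` B)"
    by (rule is_downset_dunion_Inr) (simp add: is_downset_def)
  have "is_downset (dunion_carrier A B) (dunion_rel r s) (Inr ` B \<union> Inl ` {a})"
    using component is_downset_dunion_Inl[OF assms(3)] by (rule is_downset_Un)
  moreover have "card (Inr ` B \<union> Inl ` {a}) = Suc (card B)"
    using assms(2) by (subst card_Un_disjoint) (auto simp: card_image)
  moreover have "same_Dn (Suc (card B)) Q q (dunion_carrier A B) (dunion_rel r s)"
    using assms(1) by (simp add: is_witness_def)
  ultimately obtain Y where "is_downset Q q Y"
    and "poset_iso (Inr ` B) (restr (dunion_rel r s) (Inr ` B)) Y (restr q Y)"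
    using same_Dn_sub_downset[OF _ _ _ component Un_upper1] by blast
  then show ?thesis using poset_iso_trans[OF poset_iso_dunion_Inr] by blast
qed

subsection \<open>Posets stacked on a chain\<close>

lemma card_stack_carrier: "finite A \<Longrightarrow> card (stack_carrier i A) = card A + i"
  unfolding stack_carrier_def by (subst card_Un_disjoint) (auto simp: card_image)

lemma finite_stack_carrier: "finite A \<Longrightarrow> finite (stack_carrier i A)"
  by (simp add: stack_carrier_def)

lemma is_downset_stack_bottom: "0 < i \<Longrightarrow> is_downset (stack_carrier i A) (stack_rel i A r) {Inr 0}"
  by (auto simp: is_downset_def stack_carrier_def stack_rel_def)

lemma has_least_stack: "0 < i \<Longrightarrow> has_least (stack_carrier i A) (stack_rel i A r)"
  unfolding has_least_def by (rule bexI[of _ "Inr 0"]) (auto simp: stack_carrier_def stack_rel_def)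

lemma poset_iso_stack_top: "poset_iso A r (Inl ` A) (restr (stack_rel i A r) (Inl ` A))"
  unfolding poset_iso_def
  by (rule exI[of _ Inl]) (auto simp: bij_betw_def inj_on_def restr_def stack_rel_def)

lemma card_below_stack_Inr:
  "card (below (stack_carrier i A) (stack_rel i A r) (Inr j)) \<le> i"
proof -
  have "below (stack_carrier i A) (stack_rel i A r) (Inr j) \<subseteq> Inr ` {0..<i}"
    by (auto simp: below_def stack_rel_def)
  then have "card (below (stack_carrier i A) (stack_rel i A r) (Inr j))
              \<le> card (Inr ` {0..<i} :: ('a + nat) set)"
    by (rule card_mono[rotated]) simp
  then show ?thesis by (simp add: card_image)
qed

lemma card_below_stack_Inl:
  assumes "fin_poset A r" "x \<in> A"
  shows "Suc i \<le> card (below (stack_carrier i A) (stack_rel i A r) (Inl x))"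
proof -
  have "insert (Inl x) (Inr ` {0..<i}) \<subseteq> below (stack_carrier i A) (stack_rel i A r) (Inl x)"
    using assms by (auto simp: below_def stack_carrier_def stack_rel_def fin_poset_def)
  moreover have "finite (below (stack_carrier i A) (stack_rel i A r) (Inl x))"
    using assms(1) by (simp add: below_def stack_carrier_def fin_poset_def)
  ultimately have "card (insert (Inl x) (Inr ` {0..<i}))
                     \<le> card (below (stack_carrier i A) (stack_rel i A r) (Inl x))"
    by (rule card_mono[rotated])
  moreover have "card (insert (Inl x) (Inr ` {0..<i}) :: ('a + nat) set) = Suc i"
    by (subst card_insert_disjoint) (auto simp: card_image)
  ultimately show ?thesis by simp
qed

lemma stack_Inl_iff_card_below:
  assumes "fin_poset A r" "v \<in> stack_carrier i A"
  shows "v \<in> Inl ` A \<longleftrightarrow> i < card (below (stack_carrier i A) (stack_rel i A r) v)"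
proof (cases v)
  case (Inl x)
  then have "x \<in> A" using assms(2) by (auto simp: stack_carrier_def)
  then show ?thesis using Inl card_below_stack_Inl[OF assms(1)] by (simp add: Suc_le_eq)
next
  case (Inr j)
  then show ?thesis using card_below_stack_Inr[of i A r j] by auto
qed

lemma poset_iso_stack_cancel:
  assumes A: "fin_poset A r" and B: "fin_poset B s"
    and "poset_iso (stack_carrier i A) (stack_rel i A r) (stack_carrier i B) (stack_rel i B s)"
  shows "poset_iso A r B s"
proof -
  obtain f where f: "bij_betw f (stack_carrier i A) (stack_carrier i B)"
    and h: "\<forall>x\<in>stack_carrier i A. \<forall>y\<in>stack_carrier i A.
              (x, y) \<in> stack_rel i A r \<longleftrightarrow> (f x, f y) \<in> stack_rel i B s"
    using assms(3) unfolding poset_iso_def by blast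
  have f_top: "f v \<in> Inl ` B \<longleftrightarrow> v \<in> Inl ` A" if "v \<in> stack_carrier i A" for v
    using stack_Inl_iff_card_below[OF A that] stack_Inl_iff_card_below[OF B bij_betw_apply[OF f that]]
      card_below_iso[OF f h that] by simp
  have top_A: "Inl ` A \<subseteq> stack_carrier i A" and top_B: "Inl ` B \<subseteq> stack_carrier i B"
    by (simp_all add: stack_carrier_def)
  have "f ` Inl ` A = Inl ` B"
  proof
    show "f ` Inl ` A \<subseteq> Inl ` B" using f_top top_A by blast
    show "Inl ` B \<subseteq> f ` Inl ` A"
    proof
      fix w :: "'b + nat" assume w: "w \<in> Inl ` B"
      then have "w \<in> f ` stack_carrier i A" using top_B bij_betw_imp_surj_on[OF f] by blast
      then show "w \<in> f ` Inl ` A" using f_top w by blast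
    qed
  qed
  then have "poset_iso (Inl ` A) (restr (stack_rel i A r) (Inl ` A))
                       (Inl ` B) (restr (stack_rel i B s) (Inl ` B))"
    using poset_iso_onto_image[OF f h top_A] by simp
  then have "poset_iso A r (Inl ` B) (restr (stack_rel i B s) (Inl ` B))"
    by (rule poset_iso_trans[OF poset_iso_stack_top])
  then show ?thesis using poset_iso_sym[OF poset_iso_stack_top] by (rule poset_iso_trans)
qed

theorem mainTheorem5:
  fixes P0 :: "'a set" and p :: "'a rel"
    and R0 :: "'b set" and r :: "'b rel"
    and Q :: "'c set" and q :: "'c rel"
    and m i :: nat
  assumes "fin_poset P0 p" and "fin_poset R0 r"
    and "\<not> poset_iso P0 p R0 r"
    and "card P0 = m" and "card R0 = m"
    and "i \<ge> 1"
    and "is_witness Q q (i + m + 1)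
           (dunion_carrier (stack_carrier i P0) (stack_carrier i R0))
           (dunion_rel (stack_rel i P0 p) (stack_rel i R0 r))"
  shows "card Q \<ge> 2 * m + 2 * i"
proof -
  let ?P = "stack_carrier i P0" and ?R = "stack_carrier i R0"
  let ?T = "dunion_carrier ?P ?R" and ?t = "dunion_rel (stack_rel i P0 p) (stack_rel i R0 r)"
  have fin: "finite ?P" "finite ?R"
    using assms(1,2) by (simp_all add: fin_poset_def finite_stack_carrier)
  have card: "card ?P = m + i" "card ?R = m + i"
    using assms(1,2,4,5) by (simp_all add: fin_poset_def card_stack_carrier)
  have i: "0 < i" using assms(6) by simp
  have W: "is_witness Q q (Suc (m + i)) ?T ?t" using assms(7) by (simp add: add.commute)
  then have Q: "fin_poset Q q" by (simp add: is_witness_def)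
  obtain X where X: "is_downset Q q X" "poset_iso ?P (stack_rel i P0 p) X (restr q X)"
    using witness_has_Inl_component[OF _ fin(1) is_downset_stack_bottom[OF i]] W card(1) by metis
  obtain Y where Y: "is_downset Q q Y" "poset_iso ?R (stack_rel i R0 r) Y (restr q Y)"
    using witness_has_Inr_component[OF _ fin(2) is_downset_stack_bottom[OF i]] W card(2) by metis
  have least: "has_least X q" "has_least Y q"
    using has_least_iso[OF X(2) has_least_stack[OF i]] has_least_iso[OF Y(2) has_least_stack[OF i]]
    by (simp_all add: has_least_restr)
  have card_XY: "card X = m + i" "card Y = m + i"
    using poset_iso_card[OF X(2)] poset_iso_card[OF Y(2)] card by simp_all
  have "X \<inter> Y = {} \<or> X = Y"
    using downsets_with_least_disjoint_or_eq[OF Q X(1) least(1) Y(1) least(2)]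
      witness_downset_not_has_least[OF W fin] card card_XY by simp
  moreover have "X \<noteq> Y"
  proof
    assume "X = Y"
    then have "poset_iso ?P (stack_rel i P0 p) ?R (stack_rel i R0 r)"
      using poset_iso_trans[OF X(2)] poset_iso_sym[OF Y(2)] by simp
    then show False using poset_iso_stack_cancel[OF assms(1,2)] assms(3) by blast
  qed
  moreover have "X \<union> Y \<subseteq> Q" using X(1) Y(1) by (simp add: is_downset_def)
  ultimately have "card X + card Y \<le> card Q"
    using finite_downset[OF Q X(1)] finite_downset[OF Q Y(1)] card_mono[OF _ \<open>X \<union> Y \<subseteq> Q\<close>] Q
    by (simp add: card_Un_disjoint fin_poset_def)
  then show ?thesis using card_XY by simp
qed

end
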